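(* Let $K=\mathbb{Q}(\alpha,\beta,\gamma,\delta,q,u)$ be the field of rational functions in the indeterminates $\alpha,\beta,\gamma,\delta,q,u$, and let $\lambda=(\lambda_n)_{n\geqslant 0}\in K^{\mathbb{N}}$ be any sequence. Define $h^{\lambda}:\{\bullet,\circ\}^*\to K$ recursively on word length by $h^{\lambda}(\varepsilon)=\lambda_0$ and, for every word $X$ of length $n\geqslant 0$, $$h^{\lambda}(\bullet X)=\frac{\lambda_{n+1}}{u^n\alpha\beta-q^n\gamma\delta}\Big[\alpha\delta\sum_{X=U\bullet V}u^{n-1-|\circ(U)|-|V|}q^{|\circ(U)|+|V|}\big(h^{\lambda}(U\bullet V)+h^{\lambda}(U\circ V)\big)+q^n\delta\, h^{\lambda}(X)+u^{n-|\circ(X)|}q^{|\circ(X)|}\alpha\, h^{\lambda}(X)+\alpha\beta\sum_{X=U\circ V}u^{n-1-|\circ(U)|}q^{|\circ(U)|}\big(h^{\lambda}(U\bullet V)+h^{\lambda}(U\circ V)\big)\Big],$$ $$h^{\lambda}(\circ X)=\frac{\lambda_{n+1}}{u^n\alpha\beta-q^n\gamma\delta}\Big[\delta\gamma\sum_{X=U\bullet V}u^{n-1-|\circ(U)|-|V|}q^{|\circ(U)|+|V|}\big(h^{\lambda}(U\bullet V)+h^{\lambda}(U\circ V)\big)+u^{n-|\circ(X)|}q^{|\circ(X)|}\gamma\, h^{\lambda}(X)+\gamma\beta\sum_{X=U\circ V}u^{n-1-|\circ(U)|}q^{|\circ(U)|}\big(h^{\lambda}(U\bullet V)+h^{\lambda}(U\circ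 V)\big)+u^n\beta\, h^{\lambda}(X)\Big].$$ Then $g=h^{\lambda}$ satisfies, for all words $X,Y\in\{\bullet,\circ\}^*$: (I) $u\,g(X\bullet\circ Y)=q\,g(X\circ\bullet Y)+\lambda_{|X|+|Y|+2}\big(g(X\bullet Y)+g(X\circ Y)\big)$; (II) $\alpha\, g(\circ X)=\gamma\, g(\bullet X)+\lambda_{|X|+1}\, g(X)$; (III) $\beta\, g(X\bullet)=\delta\, g(X\circ)+\lambda_{|X|+1}\, g(X)$; and $g(\varepsilon)=\lambda_0$.
   Context: Words are over the two-letter alphabet $\{\bullet,\circ\}$; $\varepsilon$ is the empty word, $|X|$ the length of $X$, and $|\circ(X)|$ the number of letters $\circ$ in $X$. A sum $\sum_{X=U\bullet V}$ runs over all factorizations of $X$ as $U\bullet V$ with $U,V$ words (i.e. over all positions of a letter $\bullet$ in $X$), and similarly for $\sum_{X=U\circ V}$. The words $U\bullet V$ and $U\circ V$ inside the sums have length $n$, so the recursion is well defined; the denominator $u^n\alpha\beta-q^n\gamma\delta$ is a nonzero element of $K$. *)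

theory Defs
  imports
    Complex_Main
    "HOL-Library.Poly_Mapping"
    "HOL-Computational_Algebra.Fraction_Field"
begin

datatype indet = I_alpha | I_beta | I_gamma | I_delta | I_q | I_u

text \<open>An arbitrary linear order on the six indeterminates. Its only purpose is to make the
  polynomials below an instance of \<^class>\<open>idom\<close>, as the library's instance for
  \<^type>\<open>poly_mapping\<close> asks for linearly ordered exponents.\<close>

primrec indet_index :: "indet \<Rightarrow> nat" where
  "indet_index I_alpha = 0"
| "indet_index I_beta = 1"
| "indet_index I_gamma = 2"
| "indet_index I_delta = 3"
| "indet_index I_q = 4"
| "indet_index I_u = 5"

lemma indet_index_inject: "indet_index x = indet_index y \<longleftrightarrow> x = y"
  by (cases x; cases y) simp_all

instantiation indet :: linorder
begin

definition less_eq_indet :: "indet \<Rightarrow> indet \<Rightarrow> bool" where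
  "x \<le> y \<longleftrightarrow> indet_index x \<le> indet_index y"

definition less_indet :: "indet \<Rightarrow> indet \<Rightarrow> bool" where
  "x < y \<longleftrightarrow> indet_index x < indet_index y"

instance
  by standard (auto simp: less_eq_indet_def less_indet_def indet_index_inject)

end

text \<open>A monomial is an exponent vector \<open>indet \<Rightarrow>\<^sub>0 nat\<close>, a polynomial over the rationals is a
  finitely supported map from monomials to coefficients, and \<open>K\<close> is the field of fractions
  \<open>\<rat>(\<alpha>, \<beta>, \<gamma>, \<delta>, q, u)\<close>.\<close>

type_synonym polynomial = "(indet \<Rightarrow>\<^sub>0 nat) \<Rightarrow>\<^sub>0 rat"

type_synonym K = "polynomial fract"

definition indeterminate :: "indet \<Rightarrow> K" where
  "indeterminate i = Fract (Poly_Mapping.single (Poly_Mapping.single i 1) 1) 1"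

definition \<alpha> :: K where "\<alpha> = indeterminate I_alpha"
definition \<beta> :: K where "\<beta> = indeterminate I_beta"
definition \<gamma> :: K where "\<gamma> = indeterminate I_gamma"
definition \<delta> :: K where "\<delta> = indeterminate I_delta"
definition q :: K where "q = indeterminate I_q"
definition u :: K where "u = indeterminate I_u"

lemma indeterminate_power:
  "indeterminate i ^ n = Fract (Poly_Mapping.single (Poly_Mapping.single i n) 1) 1"
proof (induction n)
  case 0
  then show ?case by (simp add: One_fract_def)
next
  case (Suc n)
  then show ?case
    by (simp add: indeterminate_def mult_single single_add[symmetric] add.commute)
qed

lemma denominator_nonzero: "u ^ n * \<alpha> * \<beta> - q ^ n * \<gamma> * \<delta> \<noteq> 0"
proof
  let ?s = "\<lambda>i n. Poly_Mapping.single i n :: indet \<Rightarrow>\<^sub>0 nat"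
  assume "u ^ n * \<alpha> * \<beta> - q ^ n * \<gamma> * \<delta> = 0"
  then have "Poly_Mapping.single (?s I_u n + ?s I_alpha 1 + ?s I_beta 1) (1::rat)
      = Poly_Mapping.single (?s I_q n + ?s I_gamma 1 + ?s I_delta 1) 1"
    by (simp add: \<alpha>_def \<beta>_def \<gamma>_def \<delta>_def q_def u_def indeterminate_power)
      (simp add: indeterminate_def mult_single eq_fract)
  then have "?s I_u n + ?s I_alpha 1 + ?s I_beta 1 = ?s I_q n + ?s I_gamma 1 + ?s I_delta 1"
    by (metis lookup_single_eq lookup_single_not_eq zero_neq_one)
  then have "Poly_Mapping.lookup (?s I_u n + ?s I_alpha 1 + ?s I_beta 1) I_alpha
      = Poly_Mapping.lookup (?s I_q n + ?s I_gamma 1 + ?s I_delta 1) I_alpha"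
    by (rule arg_cong)
  then show False
    by (simp add: Poly_Mapping.lookup_add Poly_Mapping.lookup_single when_def)
qed

datatype letter = Bullet | Circ

type_synonym word = "letter list"

abbreviation circs :: "word \<Rightarrow> nat" where
  "circs X \<equiv> count_list X Circ"

text \<open>The finiteness matters because \<^const>\<open>sum\<close> is \<open>0\<close> over an infinite set.\<close>

lemma finite_factorizations: "finite {(U, V). X = U @ a # V}"
proof (rule finite_subset)
  show "{(U, V). X = U @ a # V} \<subseteq> (\<lambda>i. (take i X, drop (Suc i) X)) ` {..<length X}"
  proof
    fix p
    assume "p \<in> {(U, V). X = U @ a # V}"
    then obtain U V where "p = (U, V)" "X = U @ a # V"
      by auto
    then show "p \<in> (\<lambda>i. (take i X, drop (Suc i) X)) ` {..<length X}"
      by (intro image_eqI[where x = "length U"]) simp_all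
  qed
qed simp

text \<open>The subtractions on \<^typ>\<open>nat\<close> in the exponents never truncate: in the sums,
  \<open>length X - 1 = length U + length V\<close> and \<open>circs U \<le> length U\<close>.\<close>

function h :: "(nat \<Rightarrow> K) \<Rightarrow> word \<Rightarrow> K" where
  "h lam [] = lam 0"
| "h lam (Bullet # X) = (let n = length X in
     lam (n + 1) / (u ^ n * \<alpha> * \<beta> - q ^ n * \<gamma> * \<delta>) *
       (\<alpha> * \<delta> * (\<Sum>(U, V) \<in> {(U, V). X = U @ Bullet # V}.
            u ^ (n - 1 - circs U - length V) * q ^ (circs U + length V)
            * (h lam (U @ Bullet # V) + h lam (U @ Circ # V)))
        + q ^ n * \<delta> * h lam X
        + u ^ (n - circs X) * q ^ circs X * \<alpha> * h lam X
        + \<alpha> * \<beta> * (\<Sum>(U, V) \<in> {(U, V). X = U @ Circ # V}.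
            u ^ (n - 1 - circs U) * q ^ circs U
            * (h lam (U @ Bullet # V) + h lam (U @ Circ # V)))))"
| "h lam (Circ # X) = (let n = length X in
     lam (n + 1) / (u ^ n * \<alpha> * \<beta> - q ^ n * \<gamma> * \<delta>) *
       (\<delta> * \<gamma> * (\<Sum>(U, V) \<in> {(U, V). X = U @ Bullet # V}.
            u ^ (n - 1 - circs U - length V) * q ^ (circs U + length V)
            * (h lam (U @ Bullet # V) + h lam (U @ Circ # V)))
        + u ^ (n - circs X) * q ^ circs X * \<gamma> * h lam X
        + \<gamma> * \<beta> * (\<Sum>(U, V) \<in> {(U, V). X = U @ Circ # V}.
            u ^ (n - 1 - circs U) * q ^ circs U
            * (h lam (U @ Bullet # V) + h lam (U @ Circ # V)))
        + u ^ n * \<beta> * h lam X))"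
  by pat_completeness auto
termination
  by (relation "measure (\<lambda>(lam, X). length X)") auto

declare h.simps(2,3) [simp del]

end

(* The relations (I)-(III) are those of the matrix ansatz: with all lam n = 1, they are solved by
   g (X) = <w| X |e_0>, where the letters act on row vectors.  Circ acts as the shift, and the
   action of Bullet is forced entry by entry: (III) gives its entry 0 and (I) gives entry i + 1
   from entry i.  Then (II) becomes a triangular recursion for w whose pivots are, up to units,
   the denominators of the statement.  A general lam only multiplies g (X) by
   lam 0 * ... * lam (length X).  Conversely, every solution g satisfies the recursion that
   defines h: push the first letter Bullet through X to the right end with (I), turn it into
   Circ with (III), push Circ back to the left end with (I), and turn it into Bullet with (II).
   Hence g = h. *)
theory Submission
  imports Defs
begin

section \<open>Sums over the occurrences of a letter\<close>

lemma sum_factorizations_Cons: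
  fixes f :: "word \<Rightarrow> word \<Rightarrow> 'a::comm_monoid_add"
  shows "(\<Sum>(U, V) \<in> {(U, V). a # X = U @ b # V}. f U V)
    = (if a = b then f [] X else 0) + (\<Sum>(U, V) \<in> {(U, V). X = U @ b # V}. f (a # U) V)"
proof -
  let ?F = "{(U, V). X = U @ b # V}"
  let ?c = "\<lambda>(U, V). (a # U, V)"
  have split: "{(U, V). a # X = U @ b # V} = (if a = b then {([], X)} else {}) \<union> ?c ` ?F"
    by (auto simp: Cons_eq_append_conv image_iff)
  have inj: "inj_on ?c ?F"
    by (auto simp: inj_on_def)
  have image: "(\<Sum>(U, V) \<in> ?c ` ?F. f U V) = (\<Sum>(U, V) \<in> ?F. f (a # U) V)"
    by (subst sum.reindex[OF inj]) (simp add: comp_def case_prod_beta)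
  show ?thesis
    unfolding split
    by (subst sum.union_disjoint) (auto simp: finite_factorizations image)
qed

text \<open>The premise hands over the factorization, which is needed to compare exponents that
  contain truncated subtractions.\<close>

lemma sum_factorizations_scale:
  fixes f :: "word \<Rightarrow> word \<Rightarrow> 'a::semiring_0"
  assumes "\<And>U V. X = U @ b # V \<Longrightarrow> f U V = r * g U V"
  shows "(\<Sum>(U, V) \<in> {(U, V). X = U @ b # V}. f U V)
    = r * (\<Sum>(U, V) \<in> {(U, V). X = U @ b # V}. g U V)"
  unfolding sum_distrib_left using assms by (intro sum.cong) auto

section \<open>Commuting one letter through a word\<close>

text \<open>Each Circ of \<open>X\<close> that is passed turns one of the supplied factors
  \<open>u\<close> into \<open>q\<close>, and its exchange leaves the remainder indexed by that
  Circ. Passing a Bullet changes no word and costs nothing. In the induction the passed letter joins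
  the prefix \<open>P\<close>.\<close>

lemma push_Bullet_right:
  fixes g :: "word \<Rightarrow> 'a::comm_ring_1" and u q :: 'a
  assumes exchange: "\<And>X Y. u * g (X @ Bullet # Circ # Y) = q * g (X @ Circ # Bullet # Y)
      + lam (length X + length Y + 2) * (g (X @ Bullet # Y) + g (X @ Circ # Y))"
  shows "u ^ length X * g (P @ Bullet # X)
    = lam (length P + length X + 1) * (\<Sum>(U, V) \<in> {(U, V). X = U @ Circ # V}.
          u ^ (length X - 1 - circs U) * q ^ circs U
          * (g (P @ U @ Bullet # V) + g (P @ U @ Circ # V)))
      + u ^ (length X - circs X) * q ^ circs X * g (P @ X @ [Bullet])"
proof (induction X arbitrary: P)
  case Nil
  show ?case by simp
next
  case (Cons x X)
  let ?n = "length X"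
  let ?S = "\<lambda>P. \<Sum>(U, V) \<in> {(U, V). X = U @ Circ # V}.
          u ^ (?n - 1 - circs U) * q ^ circs U
          * (g (P @ U @ Bullet # V) + g (P @ U @ Circ # V))"
  let ?S' = "\<Sum>(U, V) \<in> {(U, V). X = U @ Circ # V}.
          u ^ (length (x # X) - 1 - circs (x # U)) * q ^ circs (x # U)
          * (g (P @ (x # U) @ Bullet # V) + g (P @ (x # U) @ Circ # V))"
  note IH = Cons.IH[of "P @ [x]", simplified]
  have le: "circs X \<le> ?n"
    by (rule count_le_length)
  show ?case
  proof (cases x)
    case Bullet
    have "?S' = u * ?S (P @ [x])"
    proof (rule sum_factorizations_scale)
      fix U V assume X: "X = U @ Circ # V"
      \<comment> \<open>Nothing is truncated, as
        \<open>circs U \<le> length U < length X\<close>.\<close>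
      have "length (x # X) - 1 - circs (x # U) = Suc (?n - 1 - circs U)"
        using X count_le_length[of U Circ] Bullet by simp
      then show "u ^ (length (x # X) - 1 - circs (x # U)) * q ^ circs (x # U)
          * (g (P @ (x # U) @ Bullet # V) + g (P @ (x # U) @ Circ # V))
        = u * (u ^ (length X - 1 - circs U) * q ^ circs U
          * (g ((P @ [x]) @ U @ Bullet # V) + g ((P @ [x]) @ U @ Circ # V)))"
        using Bullet by (simp add: algebra_simps)
    qed
    then show ?thesis
      using IH le Bullet
      by (simp add: sum_factorizations_Cons Suc_diff_le algebra_simps)
  next
    case Circ
    have "?S' = q * ?S (P @ [x])"
      by (rule sum_factorizations_scale) (simp add: Circ algebra_simps)
    moreover have "u ^ length (x # X) * g (P @ Bullet # x # X)
        = u ^ ?n * (q * g (P @ Circ # Bullet # X)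
            + lam (length P + ?n + 2) * (g (P @ Bullet # X) + g (P @ Circ # X)))"
      unfolding exchange[of P X, symmetric] by (simp add: Circ ac_simps)
    ultimately show ?thesis
      using IH le Circ
      by (simp add: sum_factorizations_Cons algebra_simps)
  qed
qed

text \<open>Here the passed Bullets turn \<open>u\<close> into \<open>q\<close>. At
  \<open>X = U @ Bullet # V\<close> all of \<open>V\<close> has been passed and weighs
  \<open>q ^ length V\<close>, while \<open>U\<close> still has its initial weight.\<close>

lemma push_Circ_left:
  fixes g :: "word \<Rightarrow> 'a::comm_ring_1" and u q :: 'a
  assumes exchange: "\<And>X Y. u * g (X @ Bullet # Circ # Y) = q * g (X @ Circ # Bullet # Y)
      + lam (length X + length Y + 2) * (g (X @ Bullet # Y) + g (X @ Circ # Y))"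
  shows "u ^ (length X - circs X) * q ^ circs X * g (P @ X @ [Circ])
    = lam (length P + length X + 1) * (\<Sum>(U, V) \<in> {(U, V). X = U @ Bullet # V}.
          u ^ (length X - 1 - circs U - length V) * q ^ (circs U + length V)
          * (g (P @ U @ Bullet # V) + g (P @ U @ Circ # V)))
      + q ^ length X * g (P @ Circ # X)"
proof (induction X arbitrary: P)
  case Nil
  show ?case by simp
next
  case (Cons x X)
  let ?n = "length X"
  let ?S = "\<lambda>P. \<Sum>(U, V) \<in> {(U, V). X = U @ Bullet # V}.
          u ^ (?n - 1 - circs U - length V) * q ^ (circs U + length V)
          * (g (P @ U @ Bullet # V) + g (P @ U @ Circ # V))"
  let ?S' = "\<Sum>(U, V) \<in> {(U, V). X = U @ Bullet # V}.
          u ^ (length (x # X) - 1 - circs (x # U) - length V) * q ^ (circs (x # U) + length V)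
          * (g (P @ (x # U) @ Bullet # V) + g (P @ (x # U) @ Circ # V))"
  note IH = Cons.IH[of "P @ [x]", simplified]
  have le: "circs X \<le> ?n"
    by (rule count_le_length)
  show ?case
  proof (cases x)
    case Bullet
    have "?S' = u * ?S (P @ [x])"
    proof (rule sum_factorizations_scale)
      fix U V assume X: "X = U @ Bullet # V"
      have "length (x # X) - 1 - circs (x # U) - length V
          = Suc (?n - 1 - circs U - length V)"
        using X count_le_length[of U Circ] Bullet by simp
      then show "u ^ (length (x # X) - 1 - circs (x # U) - length V)
          * q ^ (circs (x # U) + length V)
          * (g (P @ (x # U) @ Bullet # V) + g (P @ (x # U) @ Circ # V))
        = u * (u ^ (length X - 1 - circs U - length V) * q ^ (circs U + length V)
          * (g ((P @ [x]) @ U @ Bullet # V) + g ((P @ [x]) @ U @ Circ # V)))"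
        using Bullet by (simp add: algebra_simps)
    qed
    \<comment> \<open>The induction hypothesis leaves Circ just behind the head \<open>x\<close>,
      which is passed last; one more exchange moves Circ in front of it.\<close>
    moreover have "u * (q ^ ?n * g (P @ x # Circ # X))
        = q ^ ?n * (q * g (P @ Circ # Bullet # X)
            + lam (length P + ?n + 2) * (g (P @ Bullet # X) + g (P @ Circ # X)))"
      unfolding exchange[of P X, symmetric] by (simp add: Bullet ac_simps)
    moreover have "u ^ (length (x # X) - circs (x # X)) * q ^ circs (x # X) * g (P @ (x # X) @ [Circ])
        = u * (u ^ (?n - circs X) * q ^ circs X * g (P @ x # X @ [Circ]))"
      using le Bullet by (simp add: Suc_diff_le algebra_simps)
    ultimately show ?thesis
      using IH Bullet
      by (simp add: sum_factorizations_Cons algebra_simps)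
  next
    case Circ
    have "?S' = q * ?S (P @ [x])"
      by (rule sum_factorizations_scale) (simp add: Circ algebra_simps)
    moreover have "u ^ (length (x # X) - circs (x # X)) * q ^ circs (x # X) * g (P @ (x # X) @ [Circ])
        = q * (u ^ (?n - circs X) * q ^ circs X * g (P @ x # X @ [Circ]))"
      using Circ by (simp add: algebra_simps)
    ultimately show ?thesis
      using IH Circ
      by (simp add: sum_factorizations_Cons algebra_simps)
  qed
qed

section \<open>A solution from letters acting on row vectors\<close>

locale matrix_ansatz =
  fixes \<alpha> \<beta> \<gamma> \<delta> q u :: "'a::field"
  assumes beta_nonzero: "\<beta> \<noteq> 0"
    and u_nonzero: "u \<noteq> 0"
    and pivot_nonzero: "u ^ n * \<alpha> * \<beta> - q ^ n * \<gamma> * \<delta> \<noteq> 0"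
begin

text \<open>The vector changes along the recursion because (I) compares Bullet followed by Circ with
  Circ followed by Bullet, and \<open>\<lambda>j. v (Suc j)\<close> is \<open>v\<close> after
  Circ.\<close>

primrec bullet_entry :: "nat \<Rightarrow> (nat \<Rightarrow> 'a) \<Rightarrow> 'a" where
  "bullet_entry 0 v = (\<delta> * v 1 + v 0) / \<beta>"
| "bullet_entry (Suc i) v
    = (q * bullet_entry i (\<lambda>j. v (Suc j)) + bullet_entry i v + v (Suc i)) / u"

primrec act :: "letter \<Rightarrow> (nat \<Rightarrow> 'a) \<Rightarrow> nat \<Rightarrow> 'a" where
  "act Bullet v = (\<lambda>i. bullet_entry i v)"
| "act Circ v = (\<lambda>i. v (Suc i))"

lemma bullet_entry_linear:
  "bullet_entry i (\<lambda>j. r * v j + s * w j) = r * bullet_entry i v + s * bullet_entry i w"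
proof (induction i arbitrary: v w)
  case 0
  show ?case by (simp add: add_divide_distrib algebra_simps)
next
  case (Suc i)
  show ?case by (simp add: Suc.IH add_divide_distrib algebra_simps)
qed

text \<open>Linearity carries an identity between row vectors through all letters that
  follow.\<close>

lemma foldl_act_linear:
  "foldl (\<lambda>v x. act x v) (\<lambda>j. r * v j + s * w j) X i
    = r * foldl (\<lambda>v x. act x v) v X i + s * foldl (\<lambda>v x. act x v) w X i"
proof (induction X arbitrary: v w)
  case Nil
  show ?case by simp
next
  case (Cons x X)
  have "act x (\<lambda>j. r * v j + s * w j) = (\<lambda>j. r * act x v j + s * act x w j)"
    by (cases x) (simp_all add: bullet_entry_linear)
  then show ?case by (simp add: Cons.IH)
qed

lemma foldl_act_scale:
  "foldl (\<lambda>v x. act x v) (\<lambda>j. r * v j) X i = r * foldl (\<lambda>v x. act x v) v X i"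
  using foldl_act_linear[of r v 0 v] by simp

lemma foldl_act_add:
  "foldl (\<lambda>v x. act x v) (\<lambda>j. v j + w j) X i
    = foldl (\<lambda>v x. act x v) v X i + foldl (\<lambda>v x. act x v) w X i"
  using foldl_act_linear[of 1 v 1 w] by simp

lemma act_exchange:
  "(\<lambda>i. u * act Circ (act Bullet v) i)
    = (\<lambda>i. q * act Bullet (act Circ v) i + (act Bullet v i + act Circ v i))"
  using u_nonzero by (simp add: fun_eq_iff)

text \<open>The columns of the matrix of Bullet are finite, which lets (II) be solved for
  \<open>row\<close> one entry at a time.\<close>

lemma bullet_entry_cong:
  "(\<And>j. j \<le> Suc i \<Longrightarrow> v j = w j) \<Longrightarrow> bullet_entry i v = bullet_entry i w"
proof (induction i arbitrary: v w)
  case 0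
  then show ?case by simp
next
  case (Suc i)
  have "bullet_entry i v = bullet_entry i w"
    by (rule Suc.IH) (simp add: Suc.prems)
  moreover have "bullet_entry i (\<lambda>j. v (Suc j)) = bullet_entry i (\<lambda>j. w (Suc j))"
    by (rule Suc.IH) (simp add: Suc.prems)
  ultimately show ?case by (simp add: Suc.prems)
qed

text \<open>\<open>v (Suc i)\<close> reaches entry \<open>i\<close> only along the chain of
  \<open>i\<close> shifts, each giving a factor \<open>q / u\<close>, down to entry 0, which
  contributes \<open>\<delta> / \<beta>\<close>.\<close>

lemma bullet_entry_update:
  "bullet_entry i (v(Suc i := t)) = bullet_entry i v + (q / u) ^ i * (\<delta> / \<beta>) * (t - v (Suc i))"
proof (induction i arbitrary: v)
  case 0
  show ?case by (simp add: add_divide_distrib diff_divide_distrib algebra_simps)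
next
  case (Suc i)
  have same: "bullet_entry i (v(Suc (Suc i) := t)) = bullet_entry i v"
    by (rule bullet_entry_cong) simp
  have shift: "(\<lambda>j. (v(Suc (Suc i) := t)) (Suc j)) = (\<lambda>j. v (Suc j))(Suc i := t)"
    by auto
  show ?case
    unfolding bullet_entry.simps same shift Suc.IH
    by (simp add: add_divide_distrib algebra_simps)
qed

text \<open>Entry \<open>i\<close> of (II), solved for \<open>row (Suc i)\<close>. This unknown also
  sits in the Bullet term, with the coefficient from \<open>bullet_entry_update\<close>; it is set
  to 0 there and its share moved to the divisor. The guard \<open>j \<le> i\<close> also makes the
  recursion terminate.\<close>

fun row :: "nat \<Rightarrow> 'a" where
  "row 0 = 1"
| "row (Suc i) = (row i + \<gamma> * bullet_entry i (\<lambda>j. if j \<le> i then row j else 0))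
    / (\<alpha> - \<gamma> * ((q / u) ^ i * (\<delta> / \<beta>)))"

declare row.simps(2) [simp del]

lemma row_pivot_nonzero: "\<alpha> - \<gamma> * ((q / u) ^ i * (\<delta> / \<beta>)) \<noteq> 0"
proof -
  have "(\<alpha> - \<gamma> * ((q / u) ^ i * (\<delta> / \<beta>))) * (u ^ i * \<beta>) = u ^ i * \<alpha> * \<beta> - q ^ i * \<gamma> * \<delta>"
    using beta_nonzero u_nonzero by (simp add: field_simps)
  then show ?thesis
    using pivot_nonzero[of i] by auto
qed

lemma row_boundary: "\<alpha> * act Circ row i = \<gamma> * act Bullet row i + row i"
proof -
  let ?t = "\<lambda>j. if j \<le> i then row j else 0"
  \<comment> \<open>With the true value back at \<open>Suc i\<close> in place of 0, the cut-off
    vector agrees with \<open>row\<close> on every entry that is read.\<close>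
  have "bullet_entry i row = bullet_entry i (?t(Suc i := row (Suc i)))"
    by (rule bullet_entry_cong) (auto simp: le_Suc_eq)
  also have "\<dots> = bullet_entry i ?t + (q / u) ^ i * (\<delta> / \<beta>) * row (Suc i)"
    by (simp add: bullet_entry_update)
  finally have "\<gamma> * bullet_entry i row
      = \<gamma> * bullet_entry i ?t + \<gamma> * ((q / u) ^ i * (\<delta> / \<beta>)) * row (Suc i)"
    by (simp add: algebra_simps)
  moreover have "(\<alpha> - \<gamma> * ((q / u) ^ i * (\<delta> / \<beta>))) * row (Suc i)
      = row i + \<gamma> * bullet_entry i ?t"
    using row_pivot_nonzero[of i] by (simp add: row.simps(2))
  ultimately show ?thesis
    by (simp add: algebra_simps)
qed

text \<open>Entry 0 is the pairing with e_0. A word one letter shorter lacks only the last factor of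
  the product, which the relations supply as their explicit \<open>lam\<close>.\<close>

definition ansatz :: "(nat \<Rightarrow> 'a) \<Rightarrow> word \<Rightarrow> 'a" where
  "ansatz lam X = (\<Prod>i\<le>length X. lam i) * foldl (\<lambda>v x. act x v) row X 0"

lemma ansatz_Nil: "ansatz lam [] = lam 0"
  by (simp add: ansatz_def)

lemma ansatz_exchange:
  "u * ansatz lam (X @ Bullet # Circ # Y) = q * ansatz lam (X @ Circ # Bullet # Y)
    + lam (length X + length Y + 2) * (ansatz lam (X @ Bullet # Y) + ansatz lam (X @ Circ # Y))"
proof -
  let ?F = "foldl (\<lambda>v x. act x v)"
  define v where "v = ?F row X"
  have "u * ?F (act Circ (act Bullet v)) Y 0
      = q * ?F (act Bullet (act Circ v)) Y 0 + (?F (act Bullet v) Y 0 + ?F (act Circ v) Y 0)"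
    using arg_cong[OF act_exchange[of v], where f = "\<lambda>w. ?F w Y 0"]
    by (simp only: foldl_act_scale foldl_act_add)
  then show ?thesis
    by (simp add: ansatz_def v_def del: act.simps) algebra
qed

lemma ansatz_left:
  "\<alpha> * ansatz lam (Circ # X) = \<gamma> * ansatz lam (Bullet # X) + lam (length X + 1) * ansatz lam X"
proof -
  let ?F = "foldl (\<lambda>v x. act x v)"
  have "(\<lambda>i. \<alpha> * act Circ row i) = (\<lambda>i. \<gamma> * act Bullet row i + row i)"
    using row_boundary by simp
  from arg_cong[OF this, where f = "\<lambda>w. ?F w X 0"]
  have "\<alpha> * ?F (act Circ row) X 0 = \<gamma> * ?F (act Bullet row) X 0 + ?F row X 0"
    by (simp only: foldl_act_scale foldl_act_add)
  then show ?thesis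
    by (simp add: ansatz_def del: act.simps) algebra
qed

text \<open>Only entry 0 is read after the last letter, and there Bullet is defined by
  (III).\<close>

lemma ansatz_right:
  "\<beta> * ansatz lam (X @ [Bullet])
    = \<delta> * ansatz lam (X @ [Circ]) + lam (length X + 1) * ansatz lam X"
  using beta_nonzero by (simp add: ansatz_def field_simps)

end

section \<open>The recursion forced by the relations\<close>

text \<open>Two pushes and two boundary relations are four linear equations for \<open>g\<close> at
  \<open>Bullet # X\<close>, \<open>X @ [Bullet]\<close>, \<open>X @ [Circ]\<close> and
  \<open>Circ # X\<close>; elimination leaves the denominator as coefficient.\<close>

lemma letter_recursion:
  fixes g :: "word \<Rightarrow> 'a::field" and \<alpha> \<beta> \<gamma> \<delta> q u :: 'a
  assumes nonzero: "\<alpha> \<noteq> 0" "u ^ length X * \<alpha> * \<beta> - q ^ length X * \<gamma> * \<delta> \<noteq> 0"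
    and exchange: "\<And>X Y. u * g (X @ Bullet # Circ # Y) = q * g (X @ Circ # Bullet # Y)
      + lam (length X + length Y + 2) * (g (X @ Bullet # Y) + g (X @ Circ # Y))"
    and left: "\<And>X. \<alpha> * g (Circ # X) = \<gamma> * g (Bullet # X) + lam (length X + 1) * g X"
    and right: "\<And>X. \<beta> * g (X @ [Bullet]) = \<delta> * g (X @ [Circ]) + lam (length X + 1) * g X"
  defines "n \<equiv> length X"
    and "A \<equiv> \<Sum>(U, V) \<in> {(U, V). X = U @ Bullet # V}.
            u ^ (length X - 1 - circs U - length V) * q ^ (circs U + length V)
            * (g (U @ Bullet # V) + g (U @ Circ # V))"
    and "B \<equiv> \<Sum>(U, V) \<in> {(U, V). X = U @ Circ # V}.
            u ^ (length X - 1 - circs U) * q ^ circs U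
            * (g (U @ Bullet # V) + g (U @ Circ # V))"
  shows "g (Bullet # X) = lam (n + 1) / (u ^ n * \<alpha> * \<beta> - q ^ n * \<gamma> * \<delta>) *
      (\<alpha> * \<delta> * A + q ^ n * \<delta> * g X + u ^ (n - circs X) * q ^ circs X * \<alpha> * g X + \<alpha> * \<beta> * B)"
      (is ?bullet)
    and "g (Circ # X) = lam (n + 1) / (u ^ n * \<alpha> * \<beta> - q ^ n * \<gamma> * \<delta>) *
      (\<delta> * \<gamma> * A + u ^ (n - circs X) * q ^ circs X * \<gamma> * g X + \<gamma> * \<beta> * B + u ^ n * \<beta> * g X)"
      (is ?circ)
proof -
  define D where "D = u ^ n * \<alpha> * \<beta> - q ^ n * \<gamma> * \<delta>"
  define w where "w = u ^ (n - circs X) * q ^ circs X"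
  define l where "l = lam (n + 1)"
  \<comment> \<open>Names for the powers hide the symbolic exponent from
    \<open>algebra\<close>.\<close>
  define a b where "a = u ^ n" and "b = q ^ n"
  have D: "D \<noteq> 0"
    using nonzero(2) by (simp add: D_def n_def)
  have 1: "u ^ n * g (Bullet # X) = l * B + w * g (X @ [Bullet])"
    using push_Bullet_right[OF exchange, of X "[]"] by (simp add: n_def B_def w_def l_def)
  have 2: "w * g (X @ [Circ]) = l * A + q ^ n * g (Circ # X)"
    using push_Circ_left[OF exchange, of X "[]"] by (simp add: n_def A_def w_def l_def)
  have 3: "\<alpha> * g (Circ # X) = \<gamma> * g (Bullet # X) + l * g X"
    using left[of X] by (simp add: l_def n_def)
  have 4: "\<beta> * g (X @ [Bullet]) = \<delta> * g (X @ [Circ]) + l * g X"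
    using right[of X] by (simp add: l_def n_def)
  \<comment> \<open>Add \<open>\<alpha> * \<beta>\<close> times 1,
    \<open>\<alpha> * \<delta>\<close> times 2, \<open>\<delta> * q ^ n\<close> times 3 and
    \<open>\<alpha> * w\<close> times 4.\<close>
  have bullet: "D * g (Bullet # X)
      = l * (\<alpha> * \<delta> * A + q ^ n * \<delta> * g X + w * \<alpha> * g X + \<alpha> * \<beta> * B)"
    using 1 2 3 4 unfolding D_def a_def[symmetric] b_def[symmetric] by algebra
  then show ?bullet
    using D by (simp add: D_def w_def l_def field_simps)
  \<comment> \<open>The factor \<open>\<alpha>\<close> lets 3 reduce the claim to
    \<open>bullet\<close>; the term with \<open>q ^ n\<close> cancels against the second half of
    \<open>D\<close>.\<close>
  have "\<alpha> * (D * g (Circ # X))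
      = \<alpha> * (l * (\<delta> * \<gamma> * A + w * \<gamma> * g X + \<gamma> * \<beta> * B + u ^ n * \<beta> * g X))"
    using bullet 3 unfolding D_def a_def[symmetric] b_def[symmetric] by algebra
  then have "D * g (Circ # X) = l * (\<delta> * \<gamma> * A + w * \<gamma> * g X + \<gamma> * \<beta> * B + u ^ n * \<beta> * g X)"
    using nonzero(1) by simp
  then show ?circ
    using D by (simp add: D_def w_def l_def field_simps)
qed

section \<open>Application to the field of rational functions\<close>

lemma indeterminate_nonzero: "indeterminate i \<noteq> 0"
proof
  let ?p = "Poly_Mapping.single (Poly_Mapping.single i 1) 1 :: polynomial"
  assume "indeterminate i = 0"
  then have "?p = 0"
    by (simp add: indeterminate_def Zero_fract_def eq_fract)
  then show False
    by (metis lookup_single_eq lookup_zero zero_neq_one)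
qed

interpretation K: matrix_ansatz \<alpha> \<beta> \<gamma> \<delta> q u
proof
  show "\<beta> \<noteq> 0" "u \<noteq> 0"
    by (simp_all add: \<beta>_def u_def indeterminate_nonzero)
qed (rule denominator_nonzero)

text \<open>Both sides satisfy the same recursion. The induction is on length, since the sums also
  evaluate \<open>h\<close> at the tail with one letter changed.\<close>

lemma h_eq_ansatz: "h lam X = K.ansatz lam X"
proof (induction X rule: length_induct)
  case (1 X)
  let ?g = "K.ansatz lam"
  have alpha: "\<alpha> \<noteq> 0"
    by (simp add: \<alpha>_def indeterminate_nonzero)
  note rec = letter_recursion[of \<alpha> u _ \<beta> q \<gamma> \<delta> ?g lam, OF alpha denominator_nonzero
      K.ansatz_exchange K.ansatz_left K.ansatz_right]
  show ?case
  proof (cases X)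
    case Nil
    then show ?thesis by (simp add: K.ansatz_Nil)
  next
    case (Cons x Y)
    have Y: "h lam Y = ?g Y"
      using 1 Cons by simp
    have UV: "h lam (U @ b # V) = ?g (U @ b # V)" if "Y = U @ a # V" for U V a b
      using 1 Cons that by simp
    have sums: "(\<Sum>(U, V) \<in> {(U, V). Y = U @ a # V}. f U V * (h lam (U @ Bullet # V) + h lam (U @ Circ # V)))
        = (\<Sum>(U, V) \<in> {(U, V). Y = U @ a # V}. f U V * (?g (U @ Bullet # V) + ?g (U @ Circ # V)))"
      for a f
      by (rule sum.cong) (auto simp: UV)
    show ?thesis
      by (cases x) (simp_all only: Cons h.simps Let_def sums Y rec[of Y])
  qed
qed

theorem theorem2:
  fixes lam :: "nat \<Rightarrow> K"
  shows "(\<forall>X Y. u * h lam (X @ [Bullet, Circ] @ Y)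
              = q * h lam (X @ [Circ, Bullet] @ Y)
                + lam (length X + length Y + 2)
                  * (h lam (X @ [Bullet] @ Y) + h lam (X @ [Circ] @ Y)))
       \<and> (\<forall>X. \<alpha> * h lam (Circ # X) = \<gamma> * h lam (Bullet # X) + lam (length X + 1) * h lam X)
       \<and> (\<forall>X. \<beta> * h lam (X @ [Bullet])
              = \<delta> * h lam (X @ [Circ]) + lam (length X + 1) * h lam X)
       \<and> h lam [] = lam 0"
  using K.ansatz_exchange K.ansatz_left K.ansatz_right K.ansatz_Nil
  by (simp add: h_eq_ansatz)

end
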